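(* If $G$ is a connected $P_3$-free graph with $n$ vertices, then $ch_B(G) = \chi_B(G) = \chi_S(G) = ch_S(G) = n$.
   Context: All graphs are finite and simple; $P_3$ is the path on three vertices, and $P_3$-free means no induced $P_3$. A biclique of $G$ is a set $W\subseteq V(G)$ with $G[W]$ complete bipartite $K_{n,m}$ ($n,m\ge1$); a star is a biclique inducing $K_{1,m}$; maximal means not properly contained in another biclique (resp. star). A coloring is a map $\rho:V(G)\to\mathbb N$, a $k$-coloring has values in $\{1,\dots,k\}$; a set $W$ is monochromatic if $|\rho(W)|=1$. A star (biclique) coloring has no monochromatic maximal star (biclique). For a list assignment $L$ ($L(v)\subseteq \mathbb N$, a $k$-list assignment if $|L(v)|=k$), an $L$-coloring satisfies $\rho(v)\in L(v)$; $G$ is star (biclique) $k$-choosable if for every $k$-list assignment $L$ there is an $L$-coloring with no monochromatic maximal star (biclique). $\chi_S(G)$, $\chi_B(G)$ are the minimum $k$ such that $G$ admits a star, resp. biclique, $k$-coloring; $ch_S(G)$, $ch_B(G)$ are the minimum $k$ such that $G$ is star, resp. biclique, $k$-choosable. *)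

theory Defs
  imports "Graph_Theory.Kuratowski"
begin

text \<open>
  Finite simple graphs are loop-free symmetric digraphs without parallel arcs, i.e. the locale
  \<^locale>\<open>graph\<close>; an undirected edge is a pair of opposite arcs.
\<close>

definition is_P3 :: "('a, 'b) pre_digraph \<Rightarrow> bool" where
  "is_P3 H \<longleftrightarrow> graph H \<and> (\<exists>u v w. distinct [u, v, w] \<and> verts H = {u, v, w} \<and>
     arcs_ends H = {(u, v), (v, u), (v, w), (w, v)})"

definition P3_free :: "('a, 'b) pre_digraph \<Rightarrow> bool" where
  "P3_free G \<longleftrightarrow> \<not> (\<exists>W \<subseteq> verts G. is_P3 (G \<restriction> W))"

definition biclique :: "('a, 'b) pre_digraph \<Rightarrow> 'a set \<Rightarrow> bool" where
  "biclique G W \<longleftrightarrow> W \<subseteq> verts G \<and> (\<exists>n\<ge>1. \<exists>m\<ge>1. K\<^bsub>n,m\<^esub> (G \<restriction> W))"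

definition star :: "('a, 'b) pre_digraph \<Rightarrow> 'a set \<Rightarrow> bool" where
  "star G W \<longleftrightarrow> W \<subseteq> verts G \<and> (\<exists>m\<ge>1. K\<^bsub>1,m\<^esub> (G \<restriction> W))"

definition maximal_biclique :: "('a, 'b) pre_digraph \<Rightarrow> 'a set \<Rightarrow> bool" where
  "maximal_biclique G W \<longleftrightarrow> biclique G W \<and> \<not> (\<exists>W'. biclique G W' \<and> W \<subset> W')"

definition maximal_star :: "('a, 'b) pre_digraph \<Rightarrow> 'a set \<Rightarrow> bool" where
  "maximal_star G W \<longleftrightarrow> star G W \<and> \<not> (\<exists>W'. star G W' \<and> W \<subset> W')"

text \<open>
  A coloring of \<open>G\<close> is a total function on the vertex type, of which only the values on
  \<open>verts G\<close> matter; the same holds for list assignments.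
\<close>

definition monochromatic :: "('a \<Rightarrow> nat) \<Rightarrow> 'a set \<Rightarrow> bool" where
  "monochromatic \<rho> W \<longleftrightarrow> card (\<rho> ` W) = 1"

definition star_coloring :: "('a, 'b) pre_digraph \<Rightarrow> ('a \<Rightarrow> nat) \<Rightarrow> bool" where
  "star_coloring G \<rho> \<longleftrightarrow> \<not> (\<exists>W. maximal_star G W \<and> monochromatic \<rho> W)"

definition biclique_coloring :: "('a, 'b) pre_digraph \<Rightarrow> ('a \<Rightarrow> nat) \<Rightarrow> bool" where
  "biclique_coloring G \<rho> \<longleftrightarrow> \<not> (\<exists>W. maximal_biclique G W \<and> monochromatic \<rho> W)"

definition k_coloring :: "('a, 'b) pre_digraph \<Rightarrow> nat \<Rightarrow> ('a \<Rightarrow> nat) \<Rightarrow> bool" where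
  "k_coloring G k \<rho> \<longleftrightarrow> (\<forall>v\<in>verts G. \<rho> v \<in> {1..k})"

text \<open>Finiteness excludes infinite lists, whose \<^const>\<open>card\<close> is \<open>0\<close>.\<close>

definition k_list_assignment :: "('a, 'b) pre_digraph \<Rightarrow> nat \<Rightarrow> ('a \<Rightarrow> nat set) \<Rightarrow> bool" where
  "k_list_assignment G k L \<longleftrightarrow> (\<forall>v\<in>verts G. finite (L v) \<and> card (L v) = k)"

definition list_coloring :: "('a, 'b) pre_digraph \<Rightarrow> ('a \<Rightarrow> nat set) \<Rightarrow> ('a \<Rightarrow> nat) \<Rightarrow> bool" where
  "list_coloring G L \<rho> \<longleftrightarrow> (\<forall>v\<in>verts G. \<rho> v \<in> L v)"

definition star_choosable :: "('a, 'b) pre_digraph \<Rightarrow> nat \<Rightarrow> bool" where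
  "star_choosable G k \<longleftrightarrow>
     (\<forall>L. k_list_assignment G k L \<longrightarrow> (\<exists>\<rho>. list_coloring G L \<rho> \<and> star_coloring G \<rho>))"

definition biclique_choosable :: "('a, 'b) pre_digraph \<Rightarrow> nat \<Rightarrow> bool" where
  "biclique_choosable G k \<longleftrightarrow>
     (\<forall>L. k_list_assignment G k L \<longrightarrow> (\<exists>\<rho>. list_coloring G L \<rho> \<and> biclique_coloring G \<rho>))"

definition chi_S :: "('a, 'b) pre_digraph \<Rightarrow> nat" where
  "chi_S G = (LEAST k. \<exists>\<rho>. k_coloring G k \<rho> \<and> star_coloring G \<rho>)"

definition chi_B :: "('a, 'b) pre_digraph \<Rightarrow> nat" where
  "chi_B G = (LEAST k. \<exists>\<rho>. k_coloring G k \<rho> \<and> biclique_coloring G \<rho>)"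

definition ch_S :: "('a, 'b) pre_digraph \<Rightarrow> nat" where
  "ch_S G = (LEAST k. star_choosable G k)"

definition ch_B :: "('a, 'b) pre_digraph \<Rightarrow> nat" where
  "ch_B G = (LEAST k. biclique_choosable G k)"

end

theory Submission
  imports Defs
begin

text \<open>
  In a \<open>P\<^sub>3\<close>-free graph adjacency is transitive on distinct vertices, so a connected one is
  complete. A biclique of a complete graph has at most one vertex on each side, since two vertices
  on the same side are non-adjacent; hence the bicliques and the stars are exactly the pairs of
  distinct vertices, and all of them are maximal. Both kinds of colorings are therefore the
  injective ones. These need \<open>n\<close> colors, and lists of size \<open>n\<close> always allow an injective choice.
\<close>

lemma arcs_ends_induce_subgraph: "arcs_ends (G \<restriction> W) = arcs_ends G \<inter> W \<times> W"
  by (auto simp: arcs_ends_conv)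

text \<open>Both \<open>is_P3\<close> and the complete bipartite predicate ask that the induced
  subgraph be a \<open>graph\<close>; this discharges that condition.\<close>

lemma (in graph) graph_induce_subgraph:
  assumes "W \<subseteq> verts G"
  shows "graph (G \<restriction> W)"
proof -
  have ind: "induced_subgraph (G \<restriction> W) G"
    using assms by (rule induced_induce)
  show ?thesis
    using digraphI_induced[OF ind] induced_graph_imp_symmetric[OF sym_arcs ind]
    by (rule digraph.graphI)
qed

lemma (in graph) P3_free_adj_trans:
  assumes "P3_free G" "u \<rightarrow>\<^bsub>G\<^esub> v" "v \<rightarrow>\<^bsub>G\<^esub> w" "u \<noteq> w"
  shows "u \<rightarrow>\<^bsub>G\<^esub> w"
proof (rule ccontr)
  assume nadj: "\<not> u \<rightarrow>\<^bsub>G\<^esub> w"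
  have sym: "b \<rightarrow>\<^bsub>G\<^esub> a" if "a \<rightarrow>\<^bsub>G\<^esub> b" for a b
    using sym_arcs that by (rule arcs_ends_symmetric)
  have irrefl: "\<not> a \<rightarrow>\<^bsub>G\<^esub> a" for a
    using no_loops by (auto simp: arcs_ends_conv)
  let ?W = "{u, v, w}"
  have W: "?W \<subseteq> verts G"
    using assms(2,3) adj_in_verts by blast
  then have "graph (G \<restriction> ?W)"
    by (rule graph_induce_subgraph)
  moreover have "distinct [u, v, w]"
    using assms irrefl by auto
  \<comment> \<open>Of the nine ordered pairs over \<open>?W\<close>, \<open>irrefl\<close> excludes
    the three diagonal ones, and \<open>nadj\<close> with symmetry excludes those joining
    \<open>u\<close> and \<open>w\<close>.\<close>
  moreover have "arcs_ends (G \<restriction> ?W) = {(u, v), (v, u), (v, w), (w, v)}"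
    unfolding arcs_ends_induce_subgraph
    using assms(2,3) nadj sym[OF assms(2)] sym[OF assms(3)] sym[of w u] irrefl by blast
  ultimately have "is_P3 (G \<restriction> ?W)"
    unfolding is_P3_def by (intro conjI exI[of _ u] exI[of _ v] exI[of _ w]) simp_all
  with W \<open>P3_free G\<close> show False
    unfolding P3_free_def by blast
qed

lemma (in graph) connected_P3_free_imp_complete:
  assumes "Digraph_Component.connected G" "P3_free G"
  shows "K\<^bsub>card (verts G)\<^esub> G"
proof -
  \<comment> \<open>Induction along a walk from \<open>u\<close>, shortcutting its last two arcs.
    The case \<open>u = v\<close> must be kept because a walk may return to its start, where there
    is no loop.\<close>
  have "u = v \<or> u \<rightarrow>\<^bsub>G\<^esub> v" if "u \<rightarrow>\<^sup>* v" for u v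
    using that
  proof (induction rule: reachable_induct)
    case (step x y)
    then show ?case
      using P3_free_adj_trans[OF assms(2)] by blast
  qed simp
  \<comment> \<open>Connectivity ignores the direction of arcs; symmetry turns it into reachability
    along arcs of \<open>G\<close> itself.\<close>
  moreover have "strongly_connected G"
    using assms(1) sym_arcs by (rule symmetric_connected_imp_strongly_connected[rotated])
  ultimately have "u \<rightarrow>\<^bsub>G\<^esub> v" if "u \<in> verts G" "v \<in> verts G" "u \<noteq> v" for u v
    using that unfolding strongly_connected_def by blast
  moreover have "u \<in> verts G \<and> v \<in> verts G \<and> u \<noteq> v" if "u \<rightarrow>\<^bsub>G\<^esub> v" for u v
    using that no_loops by (auto simp: arcs_ends_conv)
  ultimately have "u \<rightarrow>\<^bsub>G\<^esub> v \<longleftrightarrow> u \<in> verts G \<and> v \<in> verts G \<and> u \<noteq> v" for u v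
    by blast
  then show ?thesis
    unfolding complete_digraph_def using graph_axioms by auto
qed

lemma complete_bipartite_in_complete:
  assumes "K\<^bsub>k\<^esub> G" "W \<subseteq> verts G" "K\<^bsub>n,m\<^esub> (G \<restriction> W)" "n \<ge> 1" "m \<ge> 1"
  shows "card W = 2"
proof -
  obtain U V where UV: "W = U \<union> V" "U \<inter> V = {}" "card U = n" "card V = m"
    and ends: "arcs_ends G \<inter> W \<times> W = U \<times> V \<union> V \<times> U"
    using assms(3) unfolding complete_bipartite_digraph_def arcs_ends_induce_subgraph by auto
  have adj: "(a, b) \<in> arcs_ends G" if "a \<in> W" "b \<in> W" "a \<noteq> b" for a b
    using that assms(1,2) by (auto simp: complete_digraph_def)
  \<comment> \<open>Infinite sets have \<open>card\<close> 0, so nonempty sides in the sense of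
    \<open>n\<close>, \<open>m\<close> \<ge> 1 are finite.\<close>
  have fin: "finite U" "finite V"
    using UV assms(4,5) by (auto intro: card_ge_0_finite)
  \<comment> \<open>Distinct \<open>a\<close>, \<open>b\<close> in \<open>U\<close> would be joined
    by an arc inside \<open>W\<close>, but every such arc crosses between the disjoint
    sides.\<close>
  have "a = b" if "a \<in> U" "b \<in> U" for a b
    using that adj[of a b] ends UV(1,2) by blast
  then have "card U \<le> 1"
    using fin by (simp add: card_le_Suc0_iff_eq)
  moreover have "a = b" if "a \<in> V" "b \<in> V" for a b
    using that adj[of a b] ends UV(1,2) by blast
  then have "card V \<le> 1"
    using fin by (simp add: card_le_Suc0_iff_eq)
  ultimately show ?thesis
    using UV fin assms(4,5) by (simp add: card_Un_disjoint)
qed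

text \<open>The parameters 1, 1 suit bicliques and stars alike, so one converse serves both
  characterizations below.\<close>

lemma edge_in_complete:
  assumes "K\<^bsub>k\<^esub> G" "W \<subseteq> verts G" "card W = 2"
  shows "K\<^bsub>1,1\<^esub> (G \<restriction> W)"
proof -
  interpret graph G
    using assms(1) by (simp add: complete_digraph_def)
  obtain a b where W: "W = {a, b}" "a \<noteq> b"
    using assms(3) by (auto simp: card_2_iff)
  have "graph (G \<restriction> W)"
    using assms(2) by (rule graph_induce_subgraph)
  moreover have "arcs_ends (G \<restriction> W) = {a} \<times> {b} \<union> {b} \<times> {a}"
    using assms(1,2) W by (auto simp: arcs_ends_induce_subgraph complete_digraph_def)
  moreover have "verts (G \<restriction> W) = {a} \<union> {b}" "{a} \<inter> {b} = {}" "card {a} = 1" "card {b} = 1"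
    using W by auto
  ultimately show ?thesis
    unfolding complete_bipartite_digraph_def by blast
qed

lemma biclique_complete_iff:
  assumes "K\<^bsub>k\<^esub> G"
  shows "biclique G W \<longleftrightarrow> W \<subseteq> verts G \<and> card W = 2"
  unfolding biclique_def
  using complete_bipartite_in_complete[OF assms, of W] edge_in_complete[OF assms, of W]
  by (metis order_refl)

lemma star_complete_iff:
  assumes "K\<^bsub>k\<^esub> G"
  shows "star G W \<longleftrightarrow> W \<subseteq> verts G \<and> card W = 2"
  unfolding star_def
  using complete_bipartite_in_complete[OF assms, of W] edge_in_complete[OF assms, of W]
  by (metis order_refl)

text \<open>Makes maximality automatic once bicliques and stars are known to be pairs.\<close>

lemma pair_not_psubset_pair: "card A = 2 \<Longrightarrow> card B = 2 \<Longrightarrow> \<not> A \<subset> B"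
  using psubset_card_mono[of B A] card_ge_0_finite[of B] by fastforce

lemma no_monochromatic_pair_iff_inj_on:
  "\<not> (\<exists>W \<subseteq> A. card W = 2 \<and> monochromatic \<rho> W) \<longleftrightarrow> inj_on \<rho> A"
proof
  assume *: "\<not> (\<exists>W \<subseteq> A. card W = 2 \<and> monochromatic \<rho> W)"
  show "inj_on \<rho> A"
  proof (rule inj_onI, rule ccontr)
    fix x y assume xy: "x \<in> A" "y \<in> A" "\<rho> x = \<rho> y" "x \<noteq> y"
    then have "{x, y} \<subseteq> A \<and> card {x, y} = 2 \<and> monochromatic \<rho> {x, y}"
      by (simp add: monochromatic_def)
    with * show False
      by blast
  qed
next
  assume "inj_on \<rho> A"
  then have "card (\<rho> ` W) = card W" if "W \<subseteq> A" for W
    using that by (meson card_image inj_on_subset)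
  then show "\<not> (\<exists>W \<subseteq> A. card W = 2 \<and> monochromatic \<rho> W)"
    by (auto simp: monochromatic_def)
qed

lemma biclique_coloring_complete_iff:
  assumes "K\<^bsub>k\<^esub> G"
  shows "biclique_coloring G \<rho> \<longleftrightarrow> inj_on \<rho> (verts G)"
proof -
  have "maximal_biclique G W \<longleftrightarrow> W \<subseteq> verts G \<and> card W = 2" for W
    unfolding maximal_biclique_def biclique_complete_iff[OF assms]
    using pair_not_psubset_pair by blast
  then show ?thesis
    unfolding biclique_coloring_def no_monochromatic_pair_iff_inj_on[symmetric] by auto
qed

lemma star_coloring_complete_iff:
  assumes "K\<^bsub>k\<^esub> G"
  shows "star_coloring G \<rho> \<longleftrightarrow> inj_on \<rho> (verts G)"
proof -
  have "maximal_star G W \<longleftrightarrow> W \<subseteq> verts G \<and> card W = 2" for W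
    unfolding maximal_star_def star_complete_iff[OF assms]
    using pair_not_psubset_pair by blast
  then show ?thesis
    unfolding star_coloring_def no_monochromatic_pair_iff_inj_on[symmetric] by auto
qed

text \<open>Greedy choice, one vertex at a time. The bound is an inequality because the lists keep
  their size while \<open>A\<close> shrinks in the induction.\<close>

lemma inj_on_choice_from_large_lists:
  assumes "finite A" "\<And>v. v \<in> A \<Longrightarrow> finite (L v) \<and> card A \<le> card (L v)"
  shows "\<exists>\<rho>. (\<forall>v\<in>A. \<rho> v \<in> L v) \<and> inj_on \<rho> A"
  using assms
proof (induction A rule: finite_induct)
  case (insert x A)
  then have "\<And>v. v \<in> A \<Longrightarrow> finite (L v) \<and> card A \<le> card (L v)"
    by fastforce
  then obtain \<rho> where \<rho>: "\<forall>v\<in>A. \<rho> v \<in> L v" "inj_on \<rho> A"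
    using insert.IH by blast
  \<comment> \<open>The vertices of \<open>A\<close> occupy at most \<open>card A\<close> colors,
    and the list of \<open>x\<close> has at least one more than that.\<close>
  have "card (\<rho> ` A) < card (L x)"
    using insert.prems[of x] insert.hyps card_image_le[of A \<rho>] by simp
  then obtain c where c: "c \<in> L x" "c \<notin> \<rho> ` A"
    by (metis card_mono finite_imageI insert.hyps(1) not_le subsetI)
  have "inj_on (\<rho>(x := c)) (insert x A)"
    using \<rho>(2) c(2) insert.hyps(2) by (auto simp: inj_on_def)
  moreover have "\<forall>v\<in>insert x A. (\<rho>(x := c)) v \<in> L v"
    using \<rho>(1) c(1) by auto
  ultimately show ?case
    by blast
qed simp

text \<open>Pigeonhole; the lower bound for all four parameters. It also covers a single vertex,
  which lies in no pair but still needs a value in \<open>{1..k}\<close>.\<close>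

lemma inj_k_coloring_imp_card_le:
  assumes "k_coloring G k \<rho>" "inj_on \<rho> (verts G)"
  shows "card (verts G) \<le> k"
proof -
  have "card (verts G) \<le> card {1..k}"
    using assms by (intro card_inj_on_le[of \<rho>]) (auto simp: k_coloring_def)
  then show ?thesis
    by simp
qed

lemma Least_inj_k_coloring:
  assumes "finite (verts G)"
  shows "(LEAST k. \<exists>\<rho>. k_coloring G k \<rho> \<and> inj_on \<rho> (verts G)) = card (verts G)"
proof (rule Least_equality)
  show "\<exists>\<rho>. k_coloring G (card (verts G)) \<rho> \<and> inj_on \<rho> (verts G)"
    \<comment> \<open>A \<open>k\<close>-coloring is a choice from the constant lists
      \<open>{1..k}\<close>, so the greedy choice applies.\<close>
    unfolding k_coloring_def
    using inj_on_choice_from_large_lists[OF assms, of "\<lambda>_. {1..card (verts G)}"] by simp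
qed (use inj_k_coloring_imp_card_le in blast)

lemma Least_inj_choosable:
  assumes "finite (verts G)"
  shows "(LEAST k. \<forall>L. k_list_assignment G k L \<longrightarrow>
    (\<exists>\<rho>. list_coloring G L \<rho> \<and> inj_on \<rho> (verts G))) = card (verts G)"
proof (rule Least_equality)
  show "\<forall>L. k_list_assignment G (card (verts G)) L \<longrightarrow>
      (\<exists>\<rho>. list_coloring G L \<rho> \<and> inj_on \<rho> (verts G))"
    unfolding k_list_assignment_def list_coloring_def
    by (intro allI impI inj_on_choice_from_large_lists[OF assms]) simp
next
  fix k
  assume "\<forall>L. k_list_assignment G k L \<longrightarrow> (\<exists>\<rho>. list_coloring G L \<rho> \<and> inj_on \<rho> (verts G))"
  \<comment> \<open>Constant lists reduce the lower bound for choosability to the one for ordinary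
    colorings.\<close>
  moreover have "k_list_assignment G k (\<lambda>_. {1..k})"
    by (simp add: k_list_assignment_def)
  ultimately obtain \<rho> where "list_coloring G (\<lambda>_. {1..k}) \<rho>" "inj_on \<rho> (verts G)"
    by blast
  then show "card (verts G) \<le> k"
    by (intro inj_k_coloring_imp_card_le) (simp_all add: k_coloring_def list_coloring_def)
qed

theorem theorem18:
  fixes G :: "('a, 'b) pre_digraph" and n :: nat
  assumes "graph G" and "Digraph_Component.connected G" and "P3_free G" and "card (verts G) = n"
  shows "ch_B G = n \<and> chi_B G = n \<and> chi_S G = n \<and> ch_S G = n"
proof -
  interpret graph G
    by fact
  have complete: "K\<^bsub>n\<^esub> G"
    using connected_P3_free_imp_complete assms by blast
  show ?thesis
    \<comment> \<open>With both coloring conditions rewritten to injectivity, the four minima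
      collapse to the two \<open>LEAST\<close> expressions already evaluated.\<close>
    unfolding ch_B_def chi_B_def chi_S_def ch_S_def biclique_choosable_def star_choosable_def
      biclique_coloring_complete_iff[OF complete] star_coloring_complete_iff[OF complete]
    using Least_inj_k_coloring[OF finite_verts] Least_inj_choosable[OF finite_verts] assms(4)
    by simp
qed

end
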